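(* Let $n \ge 1$, let $t \ge 1$, and let $A \subseteq \mathbb{Z}_n \setminus \{0\}$ with $|A| = 2t$. Then there exist at least $2^t$ distinct $t$-subsets $B \subseteq A$ each of which admits an ordering $(b_1,\dots,b_t)$ whose partial sums $s_j = \sum_{i=1}^{j} b_i$ ($1 \le j \le t$, computed in $\mathbb{Z}_n$) are pairwise distinct. *)

theory Defs
  imports "HOL-Number_Theory.Residues"
begin

text \<open>
  A bijection \<open>b\<close> from \<open>{1..t}\<close> onto \<open>B\<close> encodes an ordering \<open>b 1, \<dots>, b t\<close> of \<open>B\<close>.  The empty
  partial sum is not among those required to be distinct, so later partial sums may vanish.
\<close>

definition has_distinct_partial_sums_ordering :: "int ring \<Rightarrow> nat \<Rightarrow> int set \<Rightarrow> bool" where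
  "has_distinct_partial_sums_ordering R t B \<longleftrightarrow>
     (\<exists>b. bij_betw b {1..t} B \<and> inj_on (\<lambda>j. \<Oplus>\<^bsub>R\<^esub>i\<in>{1..j}. b i) {1..t})"

end

theory Submission
  imports Defs "HOL-Combinatorics.Multiset_Permutations"
begin

text \<open>
  Build an ordering greedily.  After \<open>k\<close> elements with distinct partial sums, the next one has to
  avoid the \<open>k\<close> elements already used and the differences \<open>s\<^sub>i - s\<^sub>k\<close> with \<open>i < k\<close> (the case
  \<open>i = k\<close> is excluded by \<open>0 \<notin> A\<close>), so at least \<open>2 * t - 2 * k\<close> choices remain.  This gives at
  least \<open>2 * t * (2 * t - 2) * \<dots> * 2 = 2 ^ t * fact t\<close> orderings, and each \<open>t\<close>-subset accounts
  for at most \<open>fact t\<close> of them.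
\<close>

context abelian_group
begin

text \<open>The index runs over \<open>{1..j}\<close> and is shifted back to list positions, so that
  the sum has the same shape as in \<open>has_distinct_partial_sums_ordering\<close>.\<close>

definition partial_sum :: "'a list \<Rightarrow> nat \<Rightarrow> 'a" where
  "partial_sum xs j = (\<Oplus>i\<in>{1..j}. xs ! (i - 1))"

text \<open>Orderings are lists here because they have to be counted: a function \<open>b\<close> is
  arbitrary outside \<open>{1..t}\<close>, whereas a list represents each ordering exactly
  once.\<close>

definition distinct_sum_lists :: "'a set \<Rightarrow> nat \<Rightarrow> 'a list set" where
  "distinct_sum_lists A k = {xs. length xs = k \<and> distinct xs \<and> set xs \<subseteq> A \<and>
     inj_on (partial_sum xs) {1..k}}"

lemma partial_sum_closed:
  assumes "set xs \<subseteq> carrier G" "j \<le> length xs"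
  shows "partial_sum xs j \<in> carrier G"
proof -
  have "xs ! (i - 1) \<in> carrier G" if "i \<in> {1..j}" for i
    using that assms by (intro subsetD[OF assms(1)] nth_mem) auto
  then show ?thesis
    unfolding partial_sum_def by (intro finsum_closed) auto
qed

lemma partial_sum_append:
  assumes "set xs \<subseteq> carrier G" "j \<le> length xs"
  shows "partial_sum (xs @ ys) j = partial_sum xs j"
proof -
  have "xs ! (i - 1) \<in> carrier G" if "i \<in> {1..j}" for i
    using that assms by (intro subsetD[OF assms(1)] nth_mem) auto
  then show ?thesis
    unfolding partial_sum_def using assms by (intro finsum_cong') (auto simp: nth_append)
qed

lemma partial_sum_snoc:
  assumes "set xs \<subseteq> carrier G" "x \<in> carrier G"
  shows "partial_sum (xs @ [x]) (Suc (length xs)) = x \<oplus> partial_sum xs (length xs)"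
proof -
  have c: "(xs @ [x]) ! (i - 1) \<in> carrier G" if "i \<in> {1..length xs}" for i
    using that assms by (auto simp: nth_append intro!: subsetD[OF assms(1)] nth_mem)
  have "partial_sum (xs @ [x]) (Suc (length xs)) =
      (\<Oplus>i\<in>insert (Suc (length xs)) {1..length xs}. (xs @ [x]) ! (i - 1))"
    unfolding partial_sum_def by (simp add: atLeastAtMostSuc_conv)
  also have "\<dots> = x \<oplus> partial_sum (xs @ [x]) (length xs)"
    unfolding partial_sum_def using c assms by (subst finsum_insert) auto
  finally show ?thesis
    using partial_sum_append[OF assms(1)] by simp
qed

lemma finite_distinct_sum_lists: "finite A \<Longrightarrow> finite (distinct_sum_lists A k)"
  by (rule finite_subset[OF _ finite_lists_length_eq[of A k]]) (auto simp: distinct_sum_lists_def)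

text \<open>Appending leaves the first \<open>k\<close> partial sums unchanged, so only the new sum
  can cause a collision.\<close>

lemma snoc_in_distinct_sum_lists:
  assumes A: "A \<subseteq> carrier G - {\<zero>}"
    and xs: "xs \<in> distinct_sum_lists A k"
    and x: "x \<in> A - set xs"
    and new: "x \<notin> (\<lambda>i. partial_sum xs i \<ominus> partial_sum xs k) ` {1..<k}"
  shows "xs @ [x] \<in> distinct_sum_lists A (Suc k)"
proof -
  have len: "length xs = k" and sub: "set xs \<subseteq> carrier G" and xc: "x \<in> carrier G" "x \<noteq> \<zero>"
    and inj: "inj_on (partial_sum xs) {1..k}"
    using A xs x by (auto simp: distinct_sum_lists_def)
  have closed: "partial_sum xs i \<in> carrier G" if "i \<le> k" for i
    using partial_sum_closed sub len that by auto
  have old: "partial_sum (xs @ [x]) i = partial_sum xs i" if "i \<le> k" for i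
    using partial_sum_append sub len that by auto
  have last: "partial_sum (xs @ [x]) (Suc k) = x \<oplus> partial_sum xs k"
    using partial_sum_snoc[OF sub xc(1)] len by simp
  have "x \<oplus> partial_sum xs k \<noteq> partial_sum xs i" if i: "i \<in> {1..k}" for i
  proof
    assume "x \<oplus> partial_sum xs k = partial_sum xs i"
    \<comment> \<open>The flipped equation turns the right-hand side into
      \<open>(x \<oplus> partial_sum xs k) \<ominus> partial_sum xs k\<close>, which cancels to
      \<open>x\<close>.\<close>
    then have eq: "x = partial_sum xs i \<ominus> partial_sum xs k"
      using closed[of k] xc(1) by (simp add: minus_eq a_assoc r_neg flip: \<open>_ = partial_sum xs i\<close>)
    show False
    proof (cases "i = k")
      case True
      then show False using eq closed[of k] xc(2) by (simp add: minus_eq r_neg)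
    next
      case False
      then show False using eq new i by auto
    qed
  qed
  then have "x \<oplus> partial_sum xs k \<notin> partial_sum xs ` {1..k}"
    by blast
  moreover have "partial_sum (xs @ [x]) ` {1..k} = partial_sum xs ` {1..k}"
    by (intro image_cong) (auto simp: old)
  moreover have "inj_on (partial_sum (xs @ [x])) {1..k}"
    using inj by (subst inj_on_cong[where g = "partial_sum xs"]) (auto simp: old)
  ultimately have "inj_on (partial_sum (xs @ [x])) {1..Suc k}"
    using last by (auto simp: atLeastAtMostSuc_conv)
  then show ?thesis
    using xs x by (auto simp: distinct_sum_lists_def)
qed

text \<open>Pairs of a list and an admissible next element embed into the longer lists by appending.
  Truncated subtraction makes the bound trivial once \<open>2 * k\<close> reaches
  \<open>card A\<close>.\<close>

lemma card_distinct_sum_lists_Suc: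
  assumes A: "finite A" "A \<subseteq> carrier G - {\<zero>}"
  shows "(card A - 2 * k) * card (distinct_sum_lists A k) \<le> card (distinct_sum_lists A (Suc k))"
proof -
  define bad where
    "bad xs = (\<lambda>i. partial_sum xs i \<ominus> partial_sum xs k) ` {1..<k}" for xs
  let ?S = "Sigma (distinct_sum_lists A k) (\<lambda>xs. A - set xs - bad xs)"
  let ?snoc = "\<lambda>(xs, x). xs @ [x]"
  have many: "card A - 2 * k \<le> card (A - set xs - bad xs)"
    if "xs \<in> distinct_sum_lists A k" for xs
  proof -
    have "card (set xs) \<le> k"
      using that card_length[of xs] by (auto simp: distinct_sum_lists_def)
    \<comment> \<open>For positive \<open>k\<close> even \<open>k - 1\<close> would do; the bound
      \<open>k\<close> makes the total loss \<open>2 * k\<close>, which keeps the factors even when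
      \<open>card A\<close> is \<open>2 * t\<close>.\<close>
    moreover have "card (bad xs) \<le> k"
      unfolding bad_def by (rule order_trans[OF card_image_le]) auto
    moreover have "card A - card (set xs) \<le> card (A - set xs)"
      by (rule diff_card_le_card_Diff) simp
    moreover have "card (A - set xs) - card (bad xs) \<le> card (A - set xs - bad xs)"
      by (rule diff_card_le_card_Diff) (simp add: bad_def)
    ultimately show ?thesis by linarith
  qed
  have "(card A - 2 * k) * card (distinct_sum_lists A k) =
      (\<Sum>xs\<in>distinct_sum_lists A k. card A - 2 * k)"
    by simp
  also have "\<dots> \<le> (\<Sum>xs\<in>distinct_sum_lists A k. card (A - set xs - bad xs))"
    by (intro sum_mono many)
  also have "\<dots> = card ?S"
    using A finite_distinct_sum_lists by (subst card_SigmaI) auto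
  also have "\<dots> \<le> card (distinct_sum_lists A (Suc k))"
  proof (rule card_inj_on_le)
    show "inj_on ?snoc ?S"
      by (auto simp: inj_on_def)
    show "?snoc ` ?S \<subseteq> distinct_sum_lists A (Suc k)"
      using snoc_in_distinct_sum_lists[OF A(2)] by (auto simp: bad_def)
  qed (use A finite_distinct_sum_lists in auto)
  finally show ?thesis .
qed

lemma card_distinct_sum_lists_ge:
  assumes "finite A" "A \<subseteq> carrier G - {\<zero>}"
  shows "(\<Prod>i<k. card A - 2 * i) \<le> card (distinct_sum_lists A k)"
proof (induction k)
  case 0
  have "distinct_sum_lists A 0 = {[]}"
    by (auto simp: distinct_sum_lists_def)
  then show ?case by simp
next
  case (Suc k)
  have "(\<Prod>i<Suc k. card A - 2 * i) \<le> (card A - 2 * k) * card (distinct_sum_lists A k)"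
    using Suc by simp
  also have "\<dots> \<le> card (distinct_sum_lists A (Suc k))"
    by (rule card_distinct_sum_lists_Suc[OF assms])
  finally show ?case .
qed

text \<open>The lists with a given set \<open>B\<close> of entries are permutations of
  \<open>B\<close>, so each fibre of \<open>set\<close> has at most \<open>fact k\<close>
  elements.\<close>

lemma card_distinct_sum_lists_le:
  assumes "finite A"
  shows "card (distinct_sum_lists A k) \<le> fact k * card (set ` distinct_sum_lists A k)"
proof -
  let ?T = "set ` distinct_sum_lists A k"
  have fin: "finite ?T"
    using assms finite_distinct_sum_lists by auto
  have "distinct_sum_lists A k \<subseteq> (\<Union>B\<in>?T. permutations_of_set B)"
    by (auto simp: distinct_sum_lists_def permutations_of_set_def)
  then have "card (distinct_sum_lists A k) \<le> card (\<Union>B\<in>?T. permutations_of_set B)"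
    using assms finite_distinct_sum_lists by (intro card_mono) auto
  also have "\<dots> \<le> (\<Sum>B\<in>?T. card (permutations_of_set B))"
    by (rule card_UN_le[OF fin])
  also have "\<dots> = (\<Sum>B\<in>?T. fact k)"
    by (intro sum.cong) (auto simp: distinct_sum_lists_def distinct_card)
  finally show ?thesis by (simp add: mult.commute)
qed

end

lemma prod_even_diff: "(\<Prod>i<t. 2 * t - 2 * i) = 2 ^ t * (fact t :: nat)"
proof -
  have "(\<Prod>i<t. 2 * t - 2 * i) = (\<Prod>i<t. 2 * (t - i))"
    by (simp add: diff_mult_distrib2)
  also have "\<dots> = 2 ^ t * (\<Prod>i<t. t - i)"
    by (simp add: prod.distrib)
  also have "(\<Prod>i<t. t - i) = (fact t :: nat)"
    by (simp add: fact_prod_rev lessThan_atLeast0)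
  finally show ?thesis .
qed

theorem theorem5:
  fixes n t :: nat and A :: "int set"
  assumes "n \<ge> 1"
    and "t \<ge> 1"
    and "A \<subseteq> carrier (residue_ring (int n)) - {\<zero>\<^bsub>residue_ring (int n)\<^esub>}"
    and "card A = 2 * t"
  shows "card {B. B \<subseteq> A \<and> card B = t \<and>
      has_distinct_partial_sums_ordering (residue_ring (int n)) t B} \<ge> 2 ^ t"
proof -
  let ?R = "residue_ring (int n)"
  let ?T = "{B. B \<subseteq> A \<and> card B = t \<and> has_distinct_partial_sums_ordering ?R t B}"
  have fin: "finite A"
    using assms(2,4) by (intro card_ge_0_finite) simp
  have "A \<noteq> {}"
    using assms(2,4) by auto
  \<comment> \<open>The locale \<open>residues\<close> requires a modulus above 1; for
    \<open>n = 1\<close> the only residue is zero, which would leave \<open>A\<close> empty.\<close>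
  then have "n \<noteq> 1"
    using assms(3) by (auto simp: residue_ring_def)
  with assms(1) interpret residues "int n" ?R
    by unfold_locales auto
  have sub: "set ` distinct_sum_lists A t \<subseteq> ?T"
  proof (clarsimp, intro conjI)
    fix xs assume xs: "xs \<in> distinct_sum_lists A t"
    then show "set xs \<subseteq> A" "card (set xs) = t"
      by (auto simp: distinct_sum_lists_def distinct_card)
    \<comment> \<open>Orderings count from 1 and list positions from 0.\<close>
    have "bij_betw (\<lambda>i. i - 1) {1..t} {..<t}"
      by (rule bij_betw_byWitness[where f' = Suc]) auto
    moreover have "bij_betw (nth xs) {..<t} (set xs)"
      using xs by (intro bij_betw_nth) (auto simp: distinct_sum_lists_def)
    ultimately have "bij_betw (\<lambda>i. xs ! (i - 1)) {1..t} (set xs)"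
      by (auto simp: comp_def dest: bij_betw_trans)
    then show "has_distinct_partial_sums_ordering ?R t (set xs)"
      unfolding has_distinct_partial_sums_ordering_def
      using xs by (auto simp: distinct_sum_lists_def partial_sum_def[abs_def])
  qed
  \<comment> \<open>The count of lists is bounded on both sides with a factor \<open>fact t\<close>,
    which is positive and cancels at the end.\<close>
  have "fact t * 2 ^ t \<le> card (distinct_sum_lists A t)"
    using card_distinct_sum_lists_ge[OF fin assms(3), of t]
    unfolding assms(4) prod_even_diff by (simp only: mult.commute)
  also have "\<dots> \<le> fact t * card (set ` distinct_sum_lists A t)"
    by (rule card_distinct_sum_lists_le[OF fin])
  also have "\<dots> \<le> fact t * card ?T"
    using fin sub by (intro mult_le_mono card_mono) auto
  finally show ?thesis by simp
qed

end
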